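(* Let $X$ be a uniformly convex, complete metric space. Then every non-empty bounded subset $A\subseteq X$ has a unique circumcenter.
   Context: Write $|x\,y|$ for the distance in a metric space. A uniquely geodesic metric space $X$ (any two points are joined by a unique geodesic segment) is uniformly convex if for each $\varepsilon>0$ there is $\delta>0$ such that for all $x,y,z\in X$: if $|x\,y|\ge\varepsilon\max\{|z\,x|,|z\,y|\}$, then $|z\,m_{xy}|\le(1-\delta)\max\{|z\,x|,|z\,y|\}$, where $m_{xy}$ denotes the midpoint of $x$ and $y$ (the midpoint of the unique geodesic segment joining them). In particular, a uniformly convex metric space is by definition uniquely geodesic. A point $x_*\in X$ is a circumcenter of a non-empty bounded subset $A\subseteq X$ if $x_*$ minimizes over $X$ the function $r(x)=\sup_{a\in A}|x\,a|$. *)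

theory Defs
  imports "HOL-Analysis.Abstract_Metric_Spaces"
begin

context Metric_space
begin

text \<open>A geodesic from \<open>x\<close> to \<open>y\<close> is parametrised by arc length on \<open>[0, d x y]\<close>; the values of
  \<open>\<gamma>\<close> outside this interval are irrelevant.\<close>

definition geodesic_from_to :: "'a \<Rightarrow> 'a \<Rightarrow> (real \<Rightarrow> 'a) \<Rightarrow> bool" where
  "geodesic_from_to x y \<gamma> \<longleftrightarrow>
     \<gamma> \<in> {0..d x y} \<rightarrow> M \<and> \<gamma> 0 = x \<and> \<gamma> (d x y) = y \<and>
     (\<forall>s\<in>{0..d x y}. \<forall>t\<in>{0..d x y}. d (\<gamma> s) (\<gamma> t) = \<bar>s - t\<bar>)"

definition geodesic_segment :: "'a \<Rightarrow> 'a \<Rightarrow> 'a set \<Rightarrow> bool" where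
  "geodesic_segment x y S \<longleftrightarrow> (\<exists>\<gamma>. geodesic_from_to x y \<gamma> \<and> S = \<gamma> ` {0..d x y})"

definition uniquely_geodesic :: bool where
  "uniquely_geodesic \<longleftrightarrow> (\<forall>x\<in>M. \<forall>y\<in>M. \<exists>!S. geodesic_segment x y S)"

text \<open>Only meaningful in a uniquely geodesic space, see \<open>geodesic_midpoint_eq\<close> below.\<close>

definition geodesic_midpoint :: "'a \<Rightarrow> 'a \<Rightarrow> 'a" where
  "geodesic_midpoint x y = (THE m. \<exists>\<gamma>. geodesic_from_to x y \<gamma> \<and> m = \<gamma> (d x y / 2))"

definition uniformly_convex :: bool where
  "uniformly_convex \<longleftrightarrow>
     uniquely_geodesic \<and>
     (\<forall>\<epsilon>>0. \<exists>\<delta>>0. \<forall>x\<in>M. \<forall>y\<in>M. \<forall>z\<in>M.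
        d x y \<ge> \<epsilon> * max (d z x) (d z y) \<longrightarrow>
        d z (geodesic_midpoint x y) \<le> (1 - \<delta>) * max (d z x) (d z y))"

text \<open>The supremum is a genuine one only if \<open>A\<close> is non-empty and bounded.\<close>

definition circumcenter :: "'a set \<Rightarrow> 'a \<Rightarrow> bool" where
  "circumcenter A c \<longleftrightarrow> c \<in> M \<and> (\<forall>x\<in>M. (SUP a\<in>A. d c a) \<le> (SUP a\<in>A. d x a))"

lemma geodesic_from_to_unique:
  assumes "uniquely_geodesic" "x \<in> M" "y \<in> M"
    and g: "geodesic_from_to x y \<gamma>" and g': "geodesic_from_to x y \<gamma>'"
    and t: "t \<in> {0..d x y}"
  shows "\<gamma> t = \<gamma>' t"
proof -
  have "geodesic_segment x y (\<gamma> ` {0..d x y})" "geodesic_segment x y (\<gamma>' ` {0..d x y})"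
    using g g' unfolding geodesic_segment_def by blast+
  then have "\<gamma> ` {0..d x y} = \<gamma>' ` {0..d x y}"
    using assms(1-3) unfolding uniquely_geodesic_def by blast
  then obtain s where s: "s \<in> {0..d x y}" "\<gamma> t = \<gamma>' s"
    using t by blast
  have 0: "0 \<in> {0..d x y}" by simp
  have "d (\<gamma> 0) (\<gamma> t) = \<bar>0 - t\<bar>" "d (\<gamma>' 0) (\<gamma>' s) = \<bar>0 - s\<bar>"
    using g g' 0 t s(1) unfolding geodesic_from_to_def by blast+
  moreover have "\<gamma> 0 = \<gamma>' 0"
    using g g' unfolding geodesic_from_to_def by simp
  ultimately have "s = t" using s t by simp
  with s show ?thesis by simp
qed

lemma geodesic_midpoint_eq:
  assumes "uniquely_geodesic" "x \<in> M" "y \<in> M" "geodesic_from_to x y \<gamma>"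
  shows "geodesic_midpoint x y = \<gamma> (d x y / 2)"
proof -
  have half: "d x y / 2 \<in> {0..d x y}" by simp
  have "m = \<gamma> (d x y / 2)" if "\<exists>\<gamma>'. geodesic_from_to x y \<gamma>' \<and> m = \<gamma>' (d x y / 2)" for m
    using that geodesic_from_to_unique[OF assms(1-3) _ assms(4) half] by blast
  then show ?thesis
    unfolding geodesic_midpoint_def using assms(4) by blast
qed

end

end

(* The sublevel sets {x. r x \<le> \<rho>} of r x = sup_{a \<in> A} |x a| shrink to diameter 0 as \<rho> decreases to
   R = inf r: if two points x, y of such a set were far apart, uniform convexity, applied with each
   a \<in> A in the role of z, would give r m \<le> (1 - \<delta>) \<rho> < R at their midpoint m. Hence minimizing
   sequences are Cauchy, their limit is a circumcenter because r is 1-Lipschitz, and any two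
   circumcenters coincide. *)

theory Submission
  imports Defs
begin

context Metric_space
begin

definition radius_from :: "'a set \<Rightarrow> 'a \<Rightarrow> real" where
  "radius_from A x = (SUP a\<in>A. d x a)"

definition circumradius :: "'a set \<Rightarrow> real" where
  "circumradius A = (INF x\<in>M. radius_from A x)"

text \<open>The midpoint is a definite description, so membership in \<open>M\<close> has to be read
  off from an actual geodesic. It makes the midpoint a competitor in the infimum
  \<open>circumradius A\<close>.\<close>

lemma geodesic_midpoint_in_space:
  assumes "uniquely_geodesic" "x \<in> M" "y \<in> M"
  shows "geodesic_midpoint x y \<in> M"
proof -
  obtain \<gamma> where \<gamma>: "geodesic_from_to x y \<gamma>"
    using assms unfolding uniquely_geodesic_def geodesic_segment_def by blast
  have "\<gamma> (d x y / 2) \<in> M"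
    using \<gamma> unfolding geodesic_from_to_def by (auto simp: Pi_iff)
  with geodesic_midpoint_eq[OF assms \<gamma>] show ?thesis by simp
qed

text \<open>Since the maximum is nonnegative, shrinking \<delta> only weakens the bound, so \<delta>
  may be capped at 1. The cap keeps the factor \<open>1 - \<delta>\<close> nonnegative, so that the
  maximum can later be replaced by an upper bound for it.\<close>

lemma uniformly_convexE:
  assumes "uniformly_convex" "\<epsilon> > 0"
  obtains \<delta> where "0 < \<delta>" "\<delta> \<le> 1"
    "\<And>x y z. \<lbrakk>x \<in> M; y \<in> M; z \<in> M; \<epsilon> * max (d z x) (d z y) \<le> d x y\<rbrakk>
      \<Longrightarrow> d z (geodesic_midpoint x y) \<le> (1 - \<delta>) * max (d z x) (d z y)"
proof -
  obtain \<delta> where "\<delta> > 0" and \<delta>: "\<And>x y z. \<lbrakk>x \<in> M; y \<in> M; z \<in> M; \<epsilon> * max (d z x) (d z y) \<le> d x y\<rbrakk>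
      \<Longrightarrow> d z (geodesic_midpoint x y) \<le> (1 - \<delta>) * max (d z x) (d z y)"
    using assms unfolding uniformly_convex_def by metis
  show thesis
  proof (rule that[of "min \<delta> 1"])
    fix x y z
    assume *: "x \<in> M" "y \<in> M" "z \<in> M" "\<epsilon> * max (d z x) (d z y) \<le> d x y"
    have "(1 - \<delta>) * max (d z x) (d z y) \<le> (1 - min \<delta> 1) * max (d z x) (d z y)"
      by (intro mult_right_mono) (auto simp: le_max_iff_disj)
    with \<delta>[OF *] show "d z (geodesic_midpoint x y) \<le> (1 - min \<delta> 1) * max (d z x) (d z y)"
      by linarith
  qed (use \<open>\<delta> > 0\<close> in auto)
qed

lemma bdd_above_distances:
  assumes "mbounded A" "x \<in> M"
  shows "bdd_above (d x ` A)"
proof -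
  \<comment> \<open>\<open>mbounded_alt\<close> bounds distances between two points of the same set,
    so the base point \<open>x\<close> is added to \<open>A\<close>.\<close>
  have "mbounded (insert x A)" using assms by (simp add: mbounded_insert)
  then obtain B where "\<forall>a\<in>A. d x a \<le> B" unfolding mbounded_alt by blast
  then show ?thesis by (auto intro: bdd_aboveI)
qed

lemma dist_le_radius_from:
  assumes "mbounded A" "x \<in> M" "a \<in> A"
  shows "d x a \<le> radius_from A x"
  unfolding radius_from_def using assms by (intro cSUP_upper bdd_above_distances)

lemma radius_from_least:
  assumes "A \<noteq> {}" "\<And>a. a \<in> A \<Longrightarrow> d x a \<le> B"
  shows "radius_from A x \<le> B"
  unfolding radius_from_def using assms by (rule cSUP_least)

lemma radius_from_nonneg:
  assumes "mbounded A" "A \<noteq> {}" "x \<in> M"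
  shows "0 \<le> radius_from A x"
proof -
  obtain a where "a \<in> A" using assms by blast
  with assms have "d x a \<le> radius_from A x" by (intro dist_le_radius_from)
  with nonneg[of x a] show ?thesis by linarith
qed

text \<open>The triangle inequality is applied at each \<open>a\<close> and the supremum is taken
  last. This carries bounds from a minimizing sequence over to its limit.\<close>

lemma radius_from_lipschitz:
  assumes "mbounded A" "A \<noteq> {}" "x \<in> M" "y \<in> M"
  shows "radius_from A x \<le> d x y + radius_from A y"
proof (rule radius_from_least)
  fix a assume "a \<in> A"
  then have "a \<in> M" using assms mbounded_subset_mspace by blast
  then show "d x a \<le> d x y + radius_from A y"
    using triangle[of x y a] dist_le_radius_from[of A y a] assms \<open>a \<in> A\<close> by auto
qed (use assms in auto)

lemma circumradius_le:
  assumes "mbounded A" "A \<noteq> {}" "x \<in> M"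
  shows "circumradius A \<le> radius_from A x"
  unfolding circumradius_def using assms
  by (intro cINF_lower bdd_belowI[of _ 0]) (auto intro: radius_from_nonneg)

lemma circumcenter_iff:
  assumes "mbounded A" "A \<noteq> {}"
  shows "circumcenter A c \<longleftrightarrow> c \<in> M \<and> radius_from A c \<le> circumradius A"
proof
  assume "circumcenter A c"
  then show "c \<in> M \<and> radius_from A c \<le> circumradius A"
    unfolding circumcenter_def circumradius_def radius_from_def by (auto intro: cINF_greatest)
next
  assume "c \<in> M \<and> radius_from A c \<le> circumradius A"
  with circumradius_le[OF assms] show "circumcenter A c"
    unfolding circumcenter_def radius_from_def by fastforce
qed

text \<open>Uniform convexity enters both later results only through this lemma: uniqueness takes
  \<eta> to be the distance of two circumcenters, the Cauchy property takes \<eta>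
  arbitrary.\<close>

lemma radius_from_sublevel_small:
  assumes uc: "uniformly_convex" and A: "mbounded A" "A \<noteq> {}" and "\<eta> > 0"
  obtains \<rho> where "circumradius A < \<rho>"
    "\<And>x y. \<lbrakk>x \<in> M; y \<in> M; radius_from A x \<le> \<rho>; radius_from A y \<le> \<rho>\<rbrakk> \<Longrightarrow> d x y < \<eta>"
proof -
  let ?R = "circumradius A"
  have AM: "A \<subseteq> M" using A mbounded_subset_mspace by blast
  with A have "M \<noteq> {}" by blast
  then have "0 \<le> ?R"
    unfolding circumradius_def by (intro cINF_greatest radius_from_nonneg A)
  then consider "?R = 0" | "?R > 0" by linarith
  then show thesis
  proof cases
    \<comment> \<open>For R = 0 no midpoint can have radius below R, so convexity gives no
      contradiction. Instead every point of the sublevel set is within \<eta>/3 of a fixed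
      \<open>a\<close>, and two such distances sum to less than \<eta>.\<close>
    case 1
    obtain a where a: "a \<in> A" using A by blast
    show thesis
    proof (rule that[of "\<eta> / 3"])
      fix x y
      assume "x \<in> M" "y \<in> M" "radius_from A x \<le> \<eta> / 3" "radius_from A y \<le> \<eta> / 3"
      moreover have "d x a \<le> radius_from A x" "d y a \<le> radius_from A y"
        using A a \<open>x \<in> M\<close> \<open>y \<in> M\<close> by (auto intro: dist_le_radius_from)
      moreover have "d x y \<le> d x a + d y a"
        using triangle'[of x a y] a AM \<open>x \<in> M\<close> \<open>y \<in> M\<close> by (auto simp: commute)
      ultimately show "d x y < \<eta>" using \<open>\<eta> > 0\<close> by linarith
    qed (use 1 \<open>\<eta> > 0\<close> in auto)
  next
    case 2
    \<comment> \<open>With all distances to \<open>A\<close> at most \<rho> \<le> 2R, this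
      \<epsilon> makes \<epsilon> times their maximum at most \<eta>. The convexity premise then
      holds for every \<open>a\<close> at once, with a single \<delta>.\<close>
    define \<epsilon> where "\<epsilon> = \<eta> / (2 * ?R)"
    have "\<epsilon> > 0" using 2 \<open>\<eta> > 0\<close> by (simp add: \<epsilon>_def)
    obtain \<delta> where \<delta>: "0 < \<delta>" "\<delta> \<le> 1"
      and conv: "\<And>x y z. \<lbrakk>x \<in> M; y \<in> M; z \<in> M; \<epsilon> * max (d z x) (d z y) \<le> d x y\<rbrakk>
        \<Longrightarrow> d z (geodesic_midpoint x y) \<le> (1 - \<delta>) * max (d z x) (d z y)"
      using uniformly_convexE[OF uc \<open>\<epsilon> > 0\<close>] by metis
    \<comment> \<open>Chosen so that contraction by \<open>1 - \<delta>\<close> yields (1 -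
      \<open>\<delta>\<^sup>2\<close>)R < R, while \<delta> \<le> 1 still gives \<rho> \<le>
      2R.\<close>
    define \<rho> where "\<rho> = (1 + \<delta>) * ?R"
    have "?R < \<rho>" using 2 \<delta> by (simp add: \<rho>_def)
    have "\<rho> \<le> 2 * ?R" using 2 \<delta> by (simp add: \<rho>_def mult_right_mono)
    then have \<epsilon>\<rho>: "\<epsilon> * \<rho> \<le> \<eta>"
      using 2 \<open>\<eta> > 0\<close> by (simp add: \<epsilon>_def field_simps)
    have "(1 - \<delta>) * \<rho> = ?R - \<delta>\<^sup>2 * ?R"
      by (simp add: \<rho>_def algebra_simps power2_eq_square)
    then have small: "(1 - \<delta>) * \<rho> < ?R" using 2 \<delta> by simp
    show thesis
    proof (rule that[OF \<open>?R < \<rho>\<close>], rule ccontr)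
      fix x y
      assume xy: "x \<in> M" "y \<in> M" and rad: "radius_from A x \<le> \<rho>" "radius_from A y \<le> \<rho>"
        and "\<not> d x y < \<eta>"
      let ?m = "geodesic_midpoint x y"
      have m: "?m \<in> M"
        using uc xy geodesic_midpoint_in_space unfolding uniformly_convex_def by blast
      have "radius_from A ?m \<le> (1 - \<delta>) * \<rho>"
      proof (rule radius_from_least[OF \<open>A \<noteq> {}\<close>])
        fix a assume a: "a \<in> A"
        have max_le: "max (d a x) (d a y) \<le> \<rho>"
          using dist_le_radius_from[OF A(1) xy(1) a] dist_le_radius_from[OF A(1) xy(2) a] rad
          by (simp add: commute)
        then have "\<epsilon> * max (d a x) (d a y) \<le> \<epsilon> * \<rho>"
          using \<open>\<epsilon> > 0\<close> by (intro mult_left_mono) auto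
        with \<epsilon>\<rho> \<open>\<not> d x y < \<eta>\<close> have "\<epsilon> * max (d a x) (d a y) \<le> d x y" by linarith
        then have "d a ?m \<le> (1 - \<delta>) * max (d a x) (d a y)"
          using conv xy a AM by blast
        also have "\<dots> \<le> (1 - \<delta>) * \<rho>"
          using max_le \<delta> by (intro mult_left_mono) auto
        finally show "d ?m a \<le> (1 - \<delta>) * \<rho>" by (simp add: commute)
      qed
      with small circumradius_le[OF A m] show False by linarith
    qed
  qed
qed

text \<open>Two circumcenters lie in every sublevel set above R, so \<eta> = \<open>d c c'\<close>
  would give \<open>d c c' < d c c'\<close>.\<close>

lemma circumcenter_unique:
  assumes "uniformly_convex" "mbounded A" "A \<noteq> {}" "circumcenter A c" "circumcenter A c'"
  shows "c = c'"
proof (rule ccontr)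
  assume "c \<noteq> c'"
  have c: "c \<in> M" "c' \<in> M" "radius_from A c \<le> circumradius A" "radius_from A c' \<le> circumradius A"
    using assms circumcenter_iff by auto
  with \<open>c \<noteq> c'\<close> have "d c c' > 0" by simp
  then obtain \<rho> where "circumradius A < \<rho>"
    "\<And>x y. \<lbrakk>x \<in> M; y \<in> M; radius_from A x \<le> \<rho>; radius_from A y \<le> \<rho>\<rbrakk> \<Longrightarrow> d x y < d c c'"
    using radius_from_sublevel_small[OF assms(1-3)] by metis
  with c show False by (meson less_eq_real_def less_irrefl order_trans)
qed

lemma circumcenter_exists:
  assumes uc: "uniformly_convex" and "mcomplete" and A: "mbounded A" "A \<noteq> {}"
  shows "\<exists>c. circumcenter A c"
proof -
  let ?R = "circumradius A"
  have "M \<noteq> {}" using A mbounded_subset_mspace by blast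
  \<comment> \<open>\<open>Suc n\<close> matters: as \<open>1 / 0 = 0\<close>, index 0 would
    otherwise ask for a radius strictly below the infimum.\<close>
  have "\<exists>x\<in>M. radius_from A x < ?R + 1 / real (Suc n)" for n
    using cInf_lessD[of "radius_from A ` M" "?R + 1 / real (Suc n)"] \<open>M \<noteq> {}\<close>
    by (auto simp: circumradius_def)
  then obtain x where xM: "\<And>n. x n \<in> M"
    and x: "\<And>n. radius_from A (x n) < ?R + 1 / real (Suc n)" by metis
  \<comment> \<open>The sequence eventually enters each sublevel set above R; this serves both the
    Cauchy property and the estimate at the limit.\<close>
  have ev: "\<forall>\<^sub>F n in sequentially. radius_from A (x n) < \<rho>" if "?R < \<rho>" for \<rho>
  proof -
    have "\<forall>\<^sub>F n in sequentially. 1 / real (Suc n) < \<rho> - ?R"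
      using lim_1_over_n[THEN LIMSEQ_Suc] that by (intro order_tendstoD(2)) auto
    then show ?thesis
    proof eventually_elim
      case (elim n)
      with x[of n] show ?case by linarith
    qed
  qed
  have "MCauchy x"
    unfolding MCauchy_def
  proof (intro conjI allI impI)
    fix \<eta> :: real assume "\<eta> > 0"
    obtain \<rho> where "?R < \<rho>" and small:
      "\<And>x y. \<lbrakk>x \<in> M; y \<in> M; radius_from A x \<le> \<rho>; radius_from A y \<le> \<rho>\<rbrakk> \<Longrightarrow> d x y < \<eta>"
      using radius_from_sublevel_small[OF uc A \<open>\<eta> > 0\<close>] by metis
    from ev[OF this(1)] obtain N where "\<And>n. n \<ge> N \<Longrightarrow> radius_from A (x n) < \<rho>"
      unfolding eventually_sequentially by blast
    with small xM show "\<exists>N. \<forall>n n'. N \<le> n \<longrightarrow> N \<le> n' \<longrightarrow> d (x n) (x n') < \<eta>"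
      by (meson less_imp_le)
  qed (use xM in blast)
  then obtain c where c: "limitin mtopology x c sequentially"
    using \<open>mcomplete\<close> unfolding mcomplete_def by blast
  then have "c \<in> M" by (simp add: limitin_metric)
  have "radius_from A c \<le> ?R"
  proof (rule field_le_epsilon)
    fix e :: real assume "e > 0"
    have "\<forall>\<^sub>F n in sequentially. d (x n) c < e / 2"
      using c half_gt_zero[OF \<open>e > 0\<close>] unfolding limitin_metric by (blast intro: eventually_mono)
    moreover have "\<forall>\<^sub>F n in sequentially. radius_from A (x n) < ?R + e / 2"
      using \<open>e > 0\<close> by (intro ev) auto
    ultimately have "\<forall>\<^sub>F n in sequentially. radius_from A c \<le> ?R + e"
    proof eventually_elim
      case (elim n)
      have "radius_from A c \<le> d c (x n) + radius_from A (x n)"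
        by (intro radius_from_lipschitz A \<open>c \<in> M\<close> xM)
      with elim show ?case by (simp add: commute)
    qed
    \<comment> \<open>The inequality does not depend on \<open>n\<close>, and
      \<open>sequentially\<close> is a nontrivial filter, so holding eventually means
      holding.\<close>
    then show "radius_from A c \<le> ?R + e" by simp
  qed
  with \<open>c \<in> M\<close> show ?thesis using circumcenter_iff[OF A] by blast
qed

end

theorem proposition7p2:
  fixes M :: "'a set" and d :: "'a \<Rightarrow> 'a \<Rightarrow> real" and A :: "'a set"
  assumes "Metric_space M d"
    and "Metric_space.uniformly_convex M d"
    and "Metric_space.mcomplete M d"
    and "A \<subseteq> M" and "A \<noteq> {}" and "Metric_space.mbounded M d A"
  shows "\<exists>!c. Metric_space.circumcenter M d A c"
proof -
  interpret Metric_space M d by fact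
  show ?thesis
    using circumcenter_exists circumcenter_unique assms by blast
qed

end
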